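(* Let $h$ and $k$ be positive integers and let $q$ be a prime power with $q\ge hk+1$. There is no quadric of $\Sigma\simeq\mathrm{PG}(hk-1,q)$ containing all the $(h-1)$-dimensional projective spaces of the pseudo-arc $\mathcal{P}_{h,k,q}$. In particular, $\mathcal{P}_{h,k,q}$ is not an intersection of quadrics.
   Context: $\mathrm{PG}(m-1,q)$ is the $(m-1)$-dimensional projective space over $\mathbb{F}_q$; all dimensions are projective. A pseudo-arc in $\mathrm{PG}(hk-1,q)$ is a set of $(h-1)$-dimensional projective subspaces such that every subset of $k$ of them spans the entire space. $\Sigma\simeq \mathrm{PG}(hk-1,q)$ is the canonical subgeometry of $\mathrm{PG}(hk-1,q^h)$, consisting of the points $\langle(x_1,\dots,x_{hk})\rangle_{\mathbb{F}_{q^h}}$ with $(x_1,\dots,x_{hk})\in\mathbb{F}_q^{hk}\setminus\{0\}$. It is the set of fixed points of the semilinear collineation $\Psi:\langle(x_1,\dots,x_{hk})\rangle_{\mathbb{F}_{q^h}}\mapsto\langle(x_1^q,\dots,x_{hk}^q)\rangle_{\mathbb{F}_{q^h}}$ of order $h$. For a point $P$ of $\mathrm{PG}(hk-1,q^h)$, $X^*(P):=\langle P,P^{\Psi},\dots,P^{\Psi^{h-1}}\rangle_{\mathbb{F}_{q^h}}$ and $X(P):=X^*(P)\cap\Sigma$, regarded as a subspace of $\Sigma$. For $\alpha\in\mathbb{F}_{q^h}$, $P_\alpha:=\langle(1,\alpha,\alpha^2,\dots,\alpha^{hk-1})\rangle_{\mathbb{F}_{q^h}}$. $\Lambda_{h,q}$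 is a set of representatives of the orbits of size $h$ of $\mathbb{F}_{q^h}$ under $x\mapsto x^q$, and $\mathcal{P}_{h,k,q}:=\{X(P_\alpha):\alpha\in\Lambda_{h,q}\}$. A quadric of $\mathrm{PG}(m-1,q)$ is the set of points $\langle v\rangle$ with $\mathcal{Q}(v)=0$, where $\mathcal{Q}$ is a nonzero quadratic form on $\mathbb{F}_q^m$. A pseudo-arc is an intersection of quadrics if there exists a family of quadrics whose intersection contains each of its subspaces.
   Formalization: The case h = 1, k ≥ 3 is excluded, because there all points of the pseudo-arc lie on the quadric x_0 x_2 = x_1^2 and the claim is false; all cases with h ≥ 2, and h = 1 with k ≤ 2, are kept. *)

theory Defs
  imports
    "Jordan_Normal_Form.VS_Connect"
    "HOL-Number_Theory.Prime_Powers"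
    "HOL-Combinatorics.Orbits"
    "HOL-Library.Cardinality"
begin

text \<open>
  The type \<open>'a\<close> is a field with \<open>q ^ h\<close> elements, and \<open>'a vec\<close> with \<open>carrier_vec m\<close> is
  the vector space of dimension \<open>m\<close> over it. A point of the projective space is a
  one-dimensional linear subspace (a set of vectors); a projective subspace is the set of
  the points it contains.
\<close>

definition lin_span :: "nat \<Rightarrow> 'a::field vec set \<Rightarrow> 'a vec set" where
  "lin_span m S = LinearCombinations.module.span class_ring (module_vec TYPE('a) m) S"

definition proj_point :: "nat \<Rightarrow> 'a::field vec \<Rightarrow> 'a vec set" where
  "proj_point m v = lin_span m {v}"

definition PG_points :: "nat \<Rightarrow> 'a::field vec set set" where
  "PG_points m = {proj_point m v | v. v \<in> carrier_vec m \<and> v \<noteq> 0\<^sub>v m}"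

definition PG_span :: "nat \<Rightarrow> 'a::field vec set set \<Rightarrow> 'a vec set set" where
  "PG_span m S = {R \<in> PG_points m. R \<subseteq> lin_span m (\<Union>S)}"

text \<open>
  In a field with \<open>q ^ h\<close> elements, the fixed elements of \<open>x \<mapsto> x ^ q\<close> form the unique
  subfield with \<open>q\<close> elements.
\<close>

definition Fq :: "nat \<Rightarrow> 'a::field set" where
  "Fq q = {x. x ^ q = x}"

definition Fq_vecs :: "nat \<Rightarrow> nat \<Rightarrow> 'a::field vec set" where
  "Fq_vecs q m = {v \<in> carrier_vec m. \<forall>i<m. v $ i \<in> Fq q}"

definition canonical_subgeometry :: "nat \<Rightarrow> nat \<Rightarrow> 'a::field vec set set" where
  "canonical_subgeometry q m = {proj_point m v | v. v \<in> Fq_vecs q m \<and> v \<noteq> 0\<^sub>v m}"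

text \<open>
  The image of a point under the semilinear bijection \<open>v \<mapsto> (v\<^sub>i ^ q)\<^sub>i\<close>; as \<open>x \<mapsto> x ^ q\<close> is
  onto, the image of the span of \<open>v\<close> is the span of the image of \<open>v\<close>.
\<close>

definition Psi :: "nat \<Rightarrow> 'a::field vec set \<Rightarrow> 'a vec set" where
  "Psi q P = map_vec (\<lambda>x. x ^ q) ` P"

definition X_star :: "nat \<Rightarrow> nat \<Rightarrow> nat \<Rightarrow> 'a::field vec set \<Rightarrow> 'a vec set set" where
  "X_star h q m P = PG_span m {(Psi q ^^ i) P | i. i < h}"

definition X_sub :: "nat \<Rightarrow> nat \<Rightarrow> nat \<Rightarrow> 'a::field vec set \<Rightarrow> 'a vec set set" where
  "X_sub h q m P = X_star h q m P \<inter> canonical_subgeometry q m"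

definition P_pt :: "nat \<Rightarrow> 'a::field \<Rightarrow> 'a vec set" where
  "P_pt m \<alpha> = proj_point m (vec m (\<lambda>i. \<alpha> ^ i))"

definition full_frobenius_orbits :: "nat \<Rightarrow> nat \<Rightarrow> 'a::field set set" where
  "full_frobenius_orbits h q = {Or. \<exists>\<alpha>. Or = orbit (\<lambda>x. x ^ q) \<alpha> \<and> card Or = h}"

definition orbit_representatives :: "nat \<Rightarrow> nat \<Rightarrow> 'a::field set \<Rightarrow> bool" where
  "orbit_representatives h q \<Lambda> \<longleftrightarrow>
     \<Lambda> \<subseteq> \<Union>(full_frobenius_orbits h q) \<and>
     (\<forall>Or \<in> full_frobenius_orbits h q. \<exists>!\<alpha>. \<alpha> \<in> \<Lambda> \<and> \<alpha> \<in> Or)"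

definition P_arc :: "nat \<Rightarrow> nat \<Rightarrow> nat \<Rightarrow> 'a::field set \<Rightarrow> 'a vec set set set" where
  "P_arc h k q \<Lambda> = {X_sub h q (h * k) (P_pt (h * k) \<alpha>) | \<alpha>. \<alpha> \<in> \<Lambda>}"

definition quadratic_form :: "nat \<Rightarrow> nat \<Rightarrow> ('a::field vec \<Rightarrow> 'a) \<Rightarrow> bool" where
  "quadratic_form q m Q \<longleftrightarrow>
     (\<exists>a. (\<forall>j<m. \<forall>i\<le>j. a i j \<in> Fq q) \<and>
          (\<forall>v \<in> Fq_vecs q m. Q v = (\<Sum>j<m. \<Sum>i\<le>j. a i j * v $ i * v $ j)))"

text \<open>
  Quadrics of the canonical subgeometry. A quadratic form, unlike a form of higher degree,
  is zero as a polynomial as soon as it vanishes on all vectors over the subfield, so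
  ``nonzero'' may be read for the function.
\<close>

definition quadric :: "nat \<Rightarrow> nat \<Rightarrow> 'a::field vec set set \<Rightarrow> bool" where
  "quadric q m S \<longleftrightarrow>
     (\<exists>Q. quadratic_form q m Q \<and> (\<exists>v \<in> Fq_vecs q m. Q v \<noteq> 0) \<and>
          S = {proj_point m v | v. v \<in> Fq_vecs q m \<and> v \<noteq> 0\<^sub>v m \<and> Q v = 0})"

text \<open>The family is nonempty: the empty intersection would contain everything.\<close>

definition intersection_of_quadrics ::
    "nat \<Rightarrow> nat \<Rightarrow> 'a::field vec set set set \<Rightarrow> bool" where
  "intersection_of_quadrics q m A \<longleftrightarrow>
     (\<exists>F. F \<noteq> {} \<and> (\<forall>S\<in>F. quadric q m S) \<and> (\<forall>X\<in>A. X \<subseteq> \<Inter>F))"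

lemma Fq_card_UNIV: assumes "CARD('a::{field,finite}) = q" shows "Fq q = (UNIV::'a set)"
proof -
  have "x ^ q = x" for x :: 'a
  proof (cases "x = 0")
    case True then show ?thesis using assms zero_less_card_finite[where 'a='a] by simp
  next
    case False
    let ?U = "UNIV - {0::'a}"
    have "bij_betw (\<lambda>y. x*y) ?U ?U"
      by (rule bij_betwI[of _ _ _ "\<lambda>y. y / x"]) (use False in auto)
    hence "prod (\<lambda>y. x*y) ?U = \<Prod>?U" using prod.reindex_bij_betw[of "\<lambda>y. x*y" ?U ?U id] by simp
    hence "x ^ card ?U * \<Prod>?U = \<Prod>?U" by (simp add: prod.distrib)
    moreover have "\<Prod>?U \<noteq> 0" by simp
    ultimately have "x ^ card ?U = 1" by simp
    moreover have "q = Suc (card ?U)" using assms zero_less_card_finite[where 'a='a]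
      by (simp add: card_Diff_singleton)
    ultimately show ?thesis by (simp only: power_Suc mult_1_right)
  qed
  thus ?thesis by (auto simp: Fq_def)
qed



lemma lin_span_single:
  assumes v: "(v::'a::field vec) \<in> carrier_vec m"
  shows "lin_span m {v} = {c \<cdot>\<^sub>v v | c. True}"
proof -
  interpret vec_space "TYPE('a)" m .
  have *: "lincomb a {v} = a v \<cdot>\<^sub>v v" for a :: "'a vec \<Rightarrow> 'a"
    by (rule eq_vecI) (use v lincomb_index[of _ "{v}" a] lincomb_dim[of "{v}" a] in auto)
  have "span {v} = {lincomb a {v} | a. a \<in> {v} \<rightarrow> UNIV}"
    using finite_span[of "{v}"] v by auto
  also have "\<dots> = {c \<cdot>\<^sub>v v | c. True}" unfolding *
    by (auto intro: exI[of _ "\<lambda>_. c" for c])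
  finally show ?thesis by (simp add: lin_span_def)
qed

text \<open>
  The case \<open>h = 1\<close>, \<open>k \<ge> 3\<close> has to be excluded from the nonexistence theorem: there the
  pseudo-arc consists of points of the normal rational curve, which lies on the quadric
  \<open>x\<^sub>0 x\<^sub>2 = x\<^sub>1 x\<^sub>1\<close>.
\<close>

lemma P_arc_in_quadric_if_h_eq_1:
  fixes \<Lambda> :: "'a::{field,finite} set"
  assumes k: "k \<ge> 3" and q: "CARD('a) = q ^ 1"
  shows "\<exists>S. quadric q (1 * k) S \<and> (\<forall>X \<in> P_arc 1 k q \<Lambda>. X \<subseteq> S)"
proof -
  have U: "Fq q = (UNIV::'a set)" using Fq_card_UNIV[of q, where 'a='a] q by simp
  define Q :: "'a vec \<Rightarrow> 'a" where "Q v = v$0 * v$2 - v$1 * v$1" for v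
  define a :: "nat \<Rightarrow> nat \<Rightarrow> 'a" where "a i j = (if i=0\<and>j=2 then 1 else if i=1\<and>j=1 then -1 else 0)" for i j
  have S: "(\<Sum>j<k. \<Sum>i\<le>j. a i j * v $ i * v $ j) = Q v" for v
  proof -
    have "(\<Sum>j<k. \<Sum>i\<le>j. a i j * v $ i * v $ j) = (\<Sum>j<3. \<Sum>i\<le>j. a i j * v $ i * v $ j)"
      by (rule sum.mono_neutral_right) (use k in \<open>auto simp: a_def\<close>)
    also have "\<dots> = Q v" by (simp add: numeral_3_eq_3 numeral_2_eq_2 a_def Q_def)
    finally show ?thesis .
  qed
  have qf: "quadratic_form q k Q" unfolding quadratic_form_def U using S by (auto intro!: exI[of _ a])
  have nz: "\<exists>v \<in> Fq_vecs q k. Q v \<noteq> 0"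
    by (rule bexI[of _ "vec k (\<lambda>i. if i = 1 then 1 else 0)"]) (use k in \<open>auto simp: Fq_vecs_def U Q_def\<close>)
  let ?S = "{proj_point k v | v. v \<in> Fq_vecs q k \<and> v \<noteq> 0\<^sub>v k \<and> Q v = 0}"
  have "quadric q k ?S" unfolding quadric_def using qf nz by blast
  moreover have "X \<subseteq> ?S" if X: "X \<in> P_arc 1 k q \<Lambda>" for X
  proof
    fix R assume R: "R \<in> X"
    from X obtain \<alpha> where X: "X = X_sub 1 q k (P_pt k \<alpha>)" by (auto simp: P_arc_def)
    let ?p = "vec k (\<lambda>i. \<alpha> ^ i)"
    have "{(Psi q ^^ i) (P_pt k \<alpha>) | i. i < 1} = {P_pt k \<alpha>}" by auto
    with R X have Rs: "R \<subseteq> lin_span k (P_pt k \<alpha>)" and "R \<in> canonical_subgeometry q k"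
      by (auto simp: X_sub_def X_star_def PG_span_def)
    then obtain v where v: "R = proj_point k v" "v \<in> Fq_vecs q k" "v \<noteq> 0\<^sub>v k"
      by (auto simp: canonical_subgeometry_def)
    have vc: "v \<in> carrier_vec k" using v by (auto simp: Fq_vecs_def)
    have "v \<in> R" unfolding v(1) proj_point_def lin_span_single[OF vc]
      by (rule CollectI, rule exI[of _ 1]) simp
    hence "v \<in> lin_span k (lin_span k {?p})" using Rs by (auto simp: P_pt_def proj_point_def)
    also have "\<dots> = lin_span k {?p}"
    proof -
      interpret vec_space "TYPE('a)" k .
      show ?thesis unfolding lin_span_def
        using span_is_submodule[of "{?p}"] span_is_subset[of "span {?p}" "span {?p}"]
          in_own_span[of "span {?p}"] span_is_subset2[of "{?p}"] by auto
    qed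
    finally obtain c where "v = c \<cdot>\<^sub>v ?p" by (auto simp: lin_span_single)
    hence "Q v = 0" using k by (simp add: Q_def power2_eq_square)
    with v show "R \<in> ?S" by blast
  qed
  ultimately show ?thesis by auto
qed
end

theory Submission
  imports Defs "HOL-Number_Theory.Residues"
begin

text \<open>
  Write \<open>m = h k\<close>, so \<open>m < q\<close>, and let \<open>Q v = \<Sum>\<^sub>i\<^sub>\<le>\<^sub>j a\<^sub>i\<^sub>j v\<^sub>i v\<^sub>j\<close> be a form over the subfield with
  \<open>q\<close> elements, vanishing on the pseudo-arc. Let \<open>p x\<close> be the vector \<open>(1, x, \<dots>, x\<^bsup>m-1\<^esup>)\<close> and
  \<open>B\<close> the polar form of \<open>Q\<close>.

  For \<open>\<alpha> \<in> \<Lambda>\<close> and any \<open>c\<close> in the large field, the sum of the conjugates of \<open>c p \<alpha>\<close>,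
  namely \<open>\<Sum>\<^sub>i c\<^bsup>q^i\<^esup> p (\<alpha>\<^bsup>q^i\<^esup>)\<close>, has coordinates in the subfield and so represents a point of
  \<open>X(P\<^sub>\<alpha>)\<close> unless it is zero (\<open>proj_point_trace_vec_in_X_sub\<close>). Applying \<open>Q\<close> to it gives a
  polynomial in \<open>c\<close> with exponents \<open>q^i + q^i'\<close>. When \<open>h \<ge> 2\<close> we have \<open>q \<ge> 3\<close>, so its degree
  is at most \<open>2 q^(h-1) < q^h\<close>, and as it vanishes for all \<open>q^h\<close> values of \<open>c\<close> all its
  coefficients are zero. Two of them suffice: that of \<open>c\<^sup>2\<close> is \<open>Q (p \<alpha>)\<close>, and that
  of \<open>c\<^bsup>q+1\<^esup>\<close> is \<open>B (p \<alpha>) (p (\<alpha>\<^sup>q))\<close> (\<open>double_power_sum_coeffs_zero\<close>).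

  Both are polynomials in \<open>\<alpha>\<close> with coefficients in the subfield, so they vanish on the whole
  Frobenius orbit of \<open>\<alpha>\<close> and hence on every element with an orbit of size \<open>h\<close>
  (\<open>root_on_full_orbits\<close>). Their degrees are at most \<open>(m - 1) (q + 1) \<le> (q - 2) (q + 1)\<close>, and
  there are more such elements than that (\<open>card_full_orbit_gt\<close>): the others lie in
  the sets \<open>x\<^bsup>q^d\<^esup> = x\<close> with \<open>0 < d < h\<close>. So both polynomials are zero. In the second,
  \<open>a\<^sub>i\<^sub>j\<close> with \<open>i < j\<close> is the coefficient of \<open>x\<^bsup>i + q j\<^esup>\<close>, because exponents below \<open>q\<close> act
  as base-\<open>q\<close> digits. What remains of the first is \<open>\<Sum>\<^sub>j a\<^sub>j\<^sub>j x\<^bsup>2j\<^esup>\<close>, which kills the diagonal in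
  every characteristic, including 2, where the polar form does not see it.

  When \<open>h = 1\<close> and \<open>k \<le> 2\<close> only \<open>Q (p \<alpha>)\<close> is available. It is a polynomial of degree at most
  \<open>2 (k - 1) < q\<close> with all \<open>q\<close> elements as roots, and its coefficients are exactly the
  \<open>a\<^sub>i\<^sub>j\<close>, since the sums \<open>i + j\<close> with \<open>i \<le> j < k\<close> are then distinct.
\<close>

hide_const (open) up_ring.coeff up_ring.monom

section \<open>The Frobenius map\<close>

lemma CHAR_of_card_eq_prime_power:
  assumes "CARD('a::{field,finite}) = p ^ n" and "prime p"
  shows "CHAR('a) = p"
proof -
  have "CHAR('a) dvd p ^ n"
    using CHAR_dvd_CARD[where 'a='a] assms(1) by simp
  moreover have "prime CHAR('a)"
    by (rule prime_CHAR_semidom, rule finite_imp_CHAR_pos) simp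
  ultimately show ?thesis
    using assms(2) prime_dvd_power primes_dvd_imp_eq by blast
qed

text \<open>
  As \<open>q\<close> is a power of the characteristic, \<open>x \<mapsto> x ^ q\<close> is additive.
\<close>

lemma sum_power_subfield_card:
  fixes f :: "'b \<Rightarrow> 'a::{field,finite}"
  assumes "primepow q" and "CARD('a) = q ^ h"
  shows "(\<Sum>i\<in>A. f i) ^ q = (\<Sum>i\<in>A. f i ^ q)"
proof -
  obtain p n where p: "prime p" "q = p ^ n"
    using assms(1) by (auto simp: primepow_def)
  have "CHAR('a) = p"
    using CHAR_of_card_eq_prime_power[of p "n * h"] assms(2) p by (simp add: power_mult)
  then show ?thesis
    using p by (intro freshmans_dream_sum') auto
qed

lemma poly_Fq_power:
  fixes p :: "'a::{field,finite} poly"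
  assumes "primepow q" and "CARD('a) = q ^ h" and "\<And>i. coeff p i \<in> Fq q"
  shows "poly p (x ^ (q ^ n)) = poly p x ^ (q ^ n)"
proof (induction n)
  case (Suc n)
  have step: "poly p (y ^ q) = poly p y ^ q" for y
  proof -
    have "(coeff p i * y ^ i) ^ q = coeff p i * (y ^ q) ^ i" for i
    proof -
      have "coeff p i ^ q = coeff p i"
        using assms(3) by (simp add: Fq_def)
      moreover have "(y ^ i) ^ q = (y ^ q) ^ i"
        by (metis power_mult mult.commute)
      ultimately show ?thesis
        by (simp add: power_mult_distrib)
    qed
    then show ?thesis
      by (simp add: poly_altdef sum_power_subfield_card[OF assms(1,2)])
  qed
  show ?case
    using step[of "x ^ q ^ n"] Suc by (simp only: power_Suc2 power_mult)
qed auto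

lemma funpow_power: "((\<lambda>x. x ^ q) ^^ n) (x::'a::monoid_mult) = x ^ (q ^ n)"
  by (induction n) (simp_all add: power_Suc2 power_mult del: power_Suc)

lemma power_card_eq_self: "(x::'a::{field,finite}) ^ CARD('a) = x"
  using Fq_card_UNIV[where 'a='a] by (auto simp: Fq_def)

lemma card_power_fixed_le:
  assumes "n > 1"
  shows "card {x::'a::field. x ^ n = x} \<le> n"
proof -
  let ?p = "monom 1 n - monom 1 1 :: 'a poly"
  have "coeff ?p n = 1" using assms by simp
  then have "?p \<noteq> 0" by (metis coeff_0 zero_neq_one)
  then have "card {x. poly ?p x = 0} \<le> degree ?p" by (rule card_poly_roots_bound)
  also have "\<dots> \<le> n"
    using assms by (intro degree_diff_le order.trans[OF degree_monom_le]) auto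
  finally show ?thesis by (simp add: poly_monom)
qed

section \<open>Elements with a full Frobenius orbit\<close>

text \<open>
  The orbit consists of the \<open>x ^ (q ^ n)\<close> with \<open>n < h\<close>, so if it does not have \<open>h\<close> elements two of
  these coincide. Raising the coincidence to the power that completes the smaller exponent to
  \<open>q ^ h\<close> turns it into a return to \<open>x\<close> itself.
\<close>

lemma fixed_by_smaller_power_if_orbit_small:
  fixes x :: "'a::{field,finite}"
  assumes "CARD('a) = q ^ h" and "h > 0" and "card (orbit (\<lambda>x. x ^ q) x) \<noteq> h"
  shows "\<exists>d. 0 < d \<and> d < h \<and> x ^ (q ^ d) = x"
proof -
  have fix_h: "y ^ (q ^ h) = y" for y :: 'a
    using power_card_eq_self[of y] assms(1) by simp
  have orb: "orbit (\<lambda>x. x ^ q) x = (\<lambda>n. x ^ (q ^ n)) ` {..<h}"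
    using orbit_altdef_bounded[of h "\<lambda>x. x ^ q" x] fix_h assms(2)
    by (auto simp: funpow_power)
  have "\<not> inj_on (\<lambda>n. x ^ (q ^ n)) {..<h}"
    using assms(3) card_image unfolding orb by fastforce
  then obtain i j where ij: "i < j" "j < h" "x ^ (q ^ i) = x ^ (q ^ j)"
    unfolding inj_on_def by (metis lessThan_iff linorder_neqE_nat)
  have iterate: "(x ^ (q ^ a)) ^ (q ^ b) = x ^ (q ^ (a + b))" for a b
    by (simp add: power_add power_mult)
  have "x = (x ^ (q ^ i)) ^ (q ^ (h - i))"
    using fix_h[of x] ij(1,2) unfolding iterate by simp
  also have "\<dots> = (x ^ (q ^ h)) ^ (q ^ (j - i))"
    using ij(1,2) unfolding ij(3) iterate by (simp add: add.commute)
  also have "\<dots> = x ^ (q ^ (j - i))"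
    by (simp only: fix_h)
  finally show ?thesis
    using ij by (intro exI[of _ "j - i"]) auto
qed

lemma geometric_sum_bound:
  fixes q h :: nat
  assumes "q \<ge> 3" and "h \<ge> 2"
  shows "(\<Sum>d\<in>{0<..<h}. q ^ d) + (q - 2) * (q + 1) < q ^ h"
  using assms(2)
proof (induction h rule: dec_induct)
  case base
  obtain r where "q = r + 2" using assms(1) le_Suc_ex[of 2 q] by auto
  moreover have "{0<..<2::nat} = {1}" by auto
  ultimately show ?case by (simp add: power2_eq_square algebra_simps)
next
  case (step n)
  have "{0<..<Suc n} = insert n {0<..<n}" using step by auto
  then have "(\<Sum>d\<in>{0<..<Suc n}. q ^ d) + (q - 2) * (q + 1) < q ^ n + q ^ n"
    using step by simp
  also have "\<dots> = 2 * q ^ n" by simp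
  also have "\<dots> \<le> q ^ Suc n"
    unfolding power_Suc using assms(1) by (intro mult_le_mono1) simp
  finally show ?case .
qed

text \<open>
  Summing over all \<open>d\<close> with \<open>0 < d < h\<close>, rather than over the maximal proper subfields, is wasteful
  but enough. The bound is tight up to 2 for \<open>h = 2\<close>, where \<open>q ^ 2 - q\<close> elements have a full orbit.
\<close>

lemma card_full_orbit_gt:
  assumes "CARD('a::{field,finite}) = q ^ h" and "q \<ge> 3" and "h \<ge> 2"
  shows "card {x::'a. card (orbit (\<lambda>x. x ^ q) x) = h} > (q - 2) * (q + 1)"
proof -
  let ?S = "{x::'a. card (orbit (\<lambda>x. x ^ q) x) = h}"
  have "- ?S \<subseteq> (\<Union>d\<in>{0<..<h}. {x. x ^ (q ^ d) = x})"
    using fixed_by_smaller_power_if_orbit_small[OF assms(1)] assms(3) by fastforce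
  then have "card (- ?S) \<le> card (\<Union>d\<in>{0<..<h}. {x::'a. x ^ (q ^ d) = x})"
    by (intro card_mono) auto
  also have "\<dots> \<le> (\<Sum>d\<in>{0<..<h}. card {x::'a. x ^ (q ^ d) = x})"
    by (rule card_UN_le) simp
  also have "\<dots> \<le> (\<Sum>d\<in>{0<..<h}. q ^ d)"
    using assms(2) by (intro sum_mono card_power_fixed_le one_less_power) auto
  finally have "card (- ?S) + (q - 2) * (q + 1) < card ?S + card (- ?S)"
    using geometric_sum_bound[OF assms(2,3)] assms(1) card_Un_disjoint[of ?S "- ?S"] by simp
  then show ?thesis by simp
qed

section \<open>The polynomials of a quadratic form along the rational normal curve\<close>

text \<open>
  This is the quadratic form with coefficients \<open>a\<close>, read as a bilinear expression
  \<open>\<Sum>\<^sub>i\<^sub>\<le>\<^sub>j a\<^sub>i\<^sub>j u\<^sub>i v\<^sub>j\<close>, for \<open>u\<close> and \<open>v\<close> the points of the rational normal curve with parameters \<open>x ^ e\<close> and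
  \<open>x ^ f\<close>. Thus \<open>e = f = 1\<close> gives the value of the form at the point with parameter \<open>x\<close>, and the
  sum over \<open>(e, f) = (1, q)\<close> and \<open>(q, 1)\<close> gives its polar form at this point and its conjugate.
\<close>

definition form_poly :: "(nat \<Rightarrow> nat \<Rightarrow> 'a::field) \<Rightarrow> nat \<Rightarrow> nat \<Rightarrow> nat \<Rightarrow> 'a poly" where
  "form_poly a m e f = (\<Sum>j<m. \<Sum>i\<le>j. monom (a i j) (e * i + f * j))"

lemma poly_form_poly:
  "poly (form_poly a m e f) x = (\<Sum>j<m. \<Sum>i\<le>j. a i j * (x ^ e) ^ i * (x ^ f) ^ j)"
  by (simp add: form_poly_def poly_sum poly_monom power_add mult.assoc flip: power_mult)

lemma coeff_form_poly:
  "coeff (form_poly a m e f) n = (\<Sum>j<m. \<Sum>i\<le>j. if e * i + f * j = n then a i j else 0)"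
  by (simp add: form_poly_def coeff_sum)

lemma degree_form_poly: "degree (form_poly a m e f) \<le> (m - 1) * (e + f)"
  unfolding form_poly_def
proof (intro degree_sum_le)
  fix i j assume "j \<in> {..<m}" and "i \<in> {..j}"
  then have "e * i + f * j \<le> e * (m - 1) + f * (m - 1)"
    by (intro add_mono mult_le_mono) auto
  then show "degree (monom (a i j) (e * i + f * j)) \<le> (m - 1) * (e + f)"
    by (intro order.trans[OF degree_monom_le]) (simp only: add_mult_distrib2 mult.commute)
qed auto

lemma Fq_add:
  fixes x y :: "'a::{field,finite}"
  assumes "primepow q" and "CARD('a) = q ^ h" and "x \<in> Fq q" and "y \<in> Fq q"
  shows "x + y \<in> Fq q"
  using sum_power_subfield_card[OF assms(1,2), of "\<lambda>b. if b then x else y" UNIV] assms(3,4)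
  by (simp add: Fq_def UNIV_bool add.commute)

lemma coeff_form_poly_in_Fq:
  fixes a :: "nat \<Rightarrow> nat \<Rightarrow> 'a::{field,finite}"
  assumes "primepow q" and "CARD('a) = q ^ h" and "\<forall>j<m. \<forall>i\<le>j. a i j \<in> Fq q"
  shows "coeff (form_poly a m e f) n \<in> Fq q"
proof -
  have "q > 0" using assms(1) primepow_gt_Suc_0 by fastforce
  then show ?thesis
    using assms(3) unfolding coeff_form_poly Fq_def
    by (auto simp: sum_power_subfield_card[OF assms(1,2)] intro!: sum.cong)
qed

lemma form_coeffs_zero_if_diagonal_poly_zero:
  assumes "form_poly a m 1 1 = 0" and "m \<le> 2" and "j < m" and "i \<le> j"
  shows "a i j = 0"
proof -
  have "coeff (form_poly a m 1 1) (i + j) = 0"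
    using assms(1) by simp
  moreover have "m = 1 \<or> m = 2" using assms(2,3) by auto
  moreover have "i = 0 \<or> i = 1" "j = 0 \<or> j = 1" using assms(2-4) by auto
  ultimately show ?thesis
    using assms(3,4) unfolding coeff_form_poly
    by (elim disjE) (auto simp: numeral_2_eq_2)
qed

text \<open>
  The exponents \<open>i + q j\<close> with \<open>i, j < q\<close> determine \<open>i\<close> and \<open>j\<close>, so the polar polynomial shows every
  off-diagonal coefficient. On the diagonal it shows \<open>2 a\<^sub>j\<^sub>j\<close>, which says nothing in
  characteristic 2; there the first polynomial is used, in which different pairs \<open>(i, j)\<close> may
  share an exponent until the off-diagonal ones are gone.
\<close>

lemma form_coeffs_zero_if_polys_zero:
  assumes diag: "form_poly a m 1 1 = 0"
    and polar: "form_poly a m 1 q + form_poly a m q 1 = 0"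
    and "m \<le> q" and "j < m" and "i \<le> j"
  shows "a i j = 0"
proof -
  have digits: "x = x' \<and> y = y'" if "x + q * y = x' + q * y'" "x < q" "x' < q" for x y x' y'
    using that
    by (metis add_diff_cancel_left' mod_less mod_mult_self2 mult_cancel1 not_less_zero)
  have off: "a i j = 0" if "i < j" "j < m" for i j
  proof -
    \<comment> \<open>As \<open>i < j\<close>, the exponent \<open>i + q * j\<close> occurs only in the first summand of the polar polynomial:
      in the second the higher digit is the smaller index.\<close>
    have "coeff (form_poly a m 1 q) (i + q * j) = (\<Sum>j'<m. if j' = j then a i j else 0)"
      unfolding coeff_form_poly
    proof (intro sum.cong refl)
      fix j' assume "j' \<in> {..<m}"
      then have "(\<Sum>i'\<le>j'. if 1 * i' + q * j' = i + q * j then a i' j' else 0)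
          = (\<Sum>i'\<le>j'. if i' = i then (if j' = j then a i j else 0) else 0)"
      proof (intro sum.cong refl)
        fix i' assume "i' \<in> {..j'}"
        then have "i' < q" "i < q" using \<open>j' \<in> {..<m}\<close> that \<open>m \<le> q\<close> by auto
        then have "1 * i' + q * j' = i + q * j \<longleftrightarrow> i' = i \<and> j' = j"
          using digits[of i' j' i j] by auto
        then show "(if 1 * i' + q * j' = i + q * j then a i' j' else 0)
            = (if i' = i then (if j' = j then a i j else 0) else 0)" by simp
      qed
      also have "\<dots> = (if j' = j then a i j else 0)"
        using that by auto
      finally show "(\<Sum>i'\<le>j'. if 1 * i' + q * j' = i + q * j then a i' j' else 0)
          = (if j' = j then a i j else 0)" .
    qed
    moreover have "coeff (form_poly a m q 1) (i + q * j) = 0"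
      unfolding coeff_form_poly
    proof (intro sum.neutral ballI)
      fix j' i' assume "j' \<in> {..<m}" "i' \<in> {..j'}"
      then show "(if q * i' + 1 * j' = i + q * j then a i' j' else 0) = 0"
        using that \<open>m \<le> q\<close> digits[of j' i' i j] by (auto simp: add.commute)
    qed
    ultimately show ?thesis
      using arg_cong[OF polar, of "\<lambda>p. coeff p (i + q * j)"] that by simp
  qed
  show ?thesis
  proof (cases "i = j")
    case True
    have "coeff (form_poly a m 1 1) (j + j) = (\<Sum>j'<m. if j' = j then a j j else 0)"
      unfolding coeff_form_poly
    proof (intro sum.cong refl)
      fix j' assume j': "j' \<in> {..<m}"
      have "(\<Sum>i'\<le>j'. if 1 * i' + 1 * j' = j + j then a i' j' else 0)
          = (\<Sum>i'\<le>j'. if i' = j' then (if j' = j then a j j else 0) else 0)"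
      proof (intro sum.cong refl)
        fix i' assume "i' \<in> {..j'}"
        moreover have "j' + j' = j + j \<longleftrightarrow> j' = j" by arith
        ultimately show "(if 1 * i' + 1 * j' = j + j then a i' j' else 0)
            = (if i' = j' then (if j' = j then a j j else 0) else 0)"
          using off[of i' j'] j' by (auto simp: le_less)
      qed
      then show "(\<Sum>i'\<le>j'. if 1 * i' + 1 * j' = j + j then a i' j' else 0)
          = (if j' = j then a j j else 0)" by simp
    qed
    then show ?thesis using True diag \<open>j < m\<close> by simp
  qed (use off assms in auto)
qed

section \<open>Vectors over the subfield in the span of a point and its conjugates\<close>

text \<open>
  The coordinates are the traces, down to the subfield with \<open>q\<close> elements, of the \<open>c * \<alpha> ^ l\<close>.
\<close>

definition trace_vec :: "nat \<Rightarrow> nat \<Rightarrow> nat \<Rightarrow> 'a::field \<Rightarrow> 'a \<Rightarrow> 'a vec" where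
  "trace_vec h q m \<alpha> c = vec m (\<lambda>l. \<Sum>i<h. c ^ (q ^ i) * (\<alpha> ^ (q ^ i)) ^ l)"

lemma trace_vec_in_Fq_vecs:
  fixes c \<alpha> :: "'a::{field,finite}"
  assumes "primepow q" and "CARD('a) = q ^ h"
  shows "trace_vec h q m \<alpha> c \<in> Fq_vecs q m"
proof -
  have "(\<Sum>i<h. c ^ (q ^ i) * (\<alpha> ^ (q ^ i)) ^ l) ^ q = (\<Sum>i<h. c ^ (q ^ i) * (\<alpha> ^ (q ^ i)) ^ l)" for l
  proof -
    let ?t = "c * \<alpha> ^ l"
    have t: "c ^ (q ^ i) * (\<alpha> ^ (q ^ i)) ^ l = ?t ^ (q ^ i)" for i
      by (metis power_mult_distrib power_mult mult.commute)
    have "(\<Sum>i<h. ?t ^ (q ^ i)) ^ q = (\<Sum>i<h. ?t ^ (q ^ Suc i))"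
      by (simp only: sum_power_subfield_card[OF assms] power_Suc2 power_mult)
    moreover have "(\<Sum>i<h. ?t ^ (q ^ Suc i)) + ?t ^ (q ^ 0) = (\<Sum>i<h. ?t ^ (q ^ i)) + ?t ^ (q ^ h)"
      using sum.lessThan_Suc_shift[of "\<lambda>i. ?t ^ (q ^ i)" h] sum.lessThan_Suc[of "\<lambda>i. ?t ^ (q ^ i)" h]
      by (simp only: add.commute)
    moreover have "?t ^ (q ^ h) = ?t"
      using power_card_eq_self[of ?t] assms(2) by simp
    ultimately show ?thesis unfolding t by simp
  qed
  then show ?thesis by (simp add: trace_vec_def Fq_vecs_def Fq_def)
qed

lemma self_in_proj_point:
  assumes "v \<in> carrier_vec m"
  shows "v \<in> proj_point m v"
  unfolding proj_point_def lin_span_single[OF assms] by (rule CollectI, rule exI[of _ 1]) simp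

lemma conjugate_in_Psi_power:
  "vec m (\<lambda>l. (\<alpha> ^ (q ^ i)) ^ l) \<in> (Psi q ^^ i) (P_pt m \<alpha>)"
proof (induction i)
  case 0
  show ?case using self_in_proj_point[of "vec m (\<lambda>l. \<alpha> ^ l)" m] by (simp add: P_pt_def)
next
  case (Suc i)
  have "vec m (\<lambda>l. (\<alpha> ^ (q ^ Suc i)) ^ l) = map_vec (\<lambda>x. x ^ q) (vec m (\<lambda>l. (\<alpha> ^ (q ^ i)) ^ l))"
  proof (rule eq_vecI)
    have "(\<alpha> ^ q ^ Suc i) ^ l = ((\<alpha> ^ q ^ i) ^ l) ^ q" for l
      by (metis power_mult power_Suc2 mult.commute)
    then show "vec m (\<lambda>l. (\<alpha> ^ (q ^ Suc i)) ^ l) $ l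
        = map_vec (\<lambda>x. x ^ q) (vec m (\<lambda>l. (\<alpha> ^ (q ^ i)) ^ l)) $ l"
      if "l < dim_vec (map_vec (\<lambda>x. x ^ q) (vec m (\<lambda>l. (\<alpha> ^ (q ^ i)) ^ l)))" for l
      using that by simp
  qed simp
  then show ?case using Suc by (simp add: Psi_def)
qed

lemma Psi_power_subset_carrier:
  "(Psi q ^^ i) (P_pt m (\<alpha>::'a::field)) \<subseteq> carrier_vec m"
proof (induction i)
  case 0
  show ?case
    unfolding P_pt_def proj_point_def by (subst lin_span_single) (auto simp: P_pt_def)
next
  case (Suc i)
  then show ?case by (auto simp: Psi_def)
qed

lemma linear_combination_in_lin_span:
  fixes u :: "nat \<Rightarrow> 'a::field vec"
  assumes W: "W \<subseteq> carrier_vec m" and "\<And>i. i < n \<Longrightarrow> u i \<in> W"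
  shows "vec m (\<lambda>l. \<Sum>i<n. c i * u i $ l) \<in> lin_span m W"
  using assms(2)
proof (induction n)
  case 0
  interpret vec_space "TYPE('a)" m .
  have "0\<^sub>v m \<in> span W" using W span_zero by auto
  moreover have "vec m (\<lambda>l. \<Sum>i<0. c i * u i $ l) = 0\<^sub>v m" by auto
  ultimately show ?case by (simp add: lin_span_def)
next
  case (Suc n)
  interpret vec_space "TYPE('a)" m .
  have "u n \<in> carrier_vec m" using Suc.prems[of n] W by auto
  then have "vec m (\<lambda>l. \<Sum>i<Suc n. c i * u i $ l)
      = vec m (\<lambda>l. \<Sum>i<n. c i * u i $ l) + c n \<cdot>\<^sub>v u n"
    by (intro eq_vecI) auto
  moreover have "c n \<cdot>\<^sub>v u n \<in> span W"
    using W Suc.prems[of n] in_own_span[of W] by (intro smult_in_span) auto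
  moreover have "vec m (\<lambda>l. \<Sum>i<n. c i * u i $ l) \<in> span W"
    using Suc by (auto simp: lin_span_def)
  ultimately show ?case
    unfolding lin_span_def using W span_add1[of W] by auto
qed

lemma smult_in_lin_span:
  fixes v :: "'a::field vec"
  assumes "W \<subseteq> carrier_vec m" and "v \<in> lin_span m W"
  shows "c \<cdot>\<^sub>v v \<in> lin_span m W"
proof -
  interpret vec_space "TYPE('a)" m .
  show ?thesis using assms smult_in_span[of W v c] by (simp add: lin_span_def)
qed

lemma proj_point_trace_vec_in_X_sub:
  fixes c \<alpha> :: "'a::{field,finite}"
  assumes "primepow q" and "CARD('a) = q ^ h" and "trace_vec h q m \<alpha> c \<noteq> 0\<^sub>v m"
  shows "proj_point m (trace_vec h q m \<alpha> c) \<in> X_sub h q m (P_pt m \<alpha>)"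
proof -
  let ?v = "trace_vec h q m \<alpha> c" and ?W = "\<Union>{(Psi q ^^ i) (P_pt m \<alpha>) | i. i < h}"
  have v: "?v \<in> Fq_vecs q m" by (rule trace_vec_in_Fq_vecs[OF assms(1,2)])
  then have vc: "?v \<in> carrier_vec m" by (simp add: Fq_vecs_def)
  have W: "?W \<subseteq> carrier_vec m" using Psi_power_subset_carrier by blast
  have "vec m (\<lambda>l. \<Sum>i<h. c ^ (q ^ i) * vec m (\<lambda>l. (\<alpha> ^ (q ^ i)) ^ l) $ l) \<in> lin_span m ?W"
    using conjugate_in_Psi_power by (intro linear_combination_in_lin_span[OF W]) blast
  moreover have "vec m (\<lambda>l. \<Sum>i<h. c ^ (q ^ i) * vec m (\<lambda>l. (\<alpha> ^ (q ^ i)) ^ l) $ l) = ?v"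
    by (rule eq_vecI) (auto simp: trace_vec_def)
  ultimately have "?v \<in> lin_span m ?W" by simp
  then have "proj_point m ?v \<subseteq> lin_span m ?W"
    unfolding proj_point_def lin_span_single[OF vc] using smult_in_lin_span[OF W] by blast
  then show ?thesis
    using v vc assms(3)
    unfolding X_sub_def X_star_def PG_span_def PG_points_def canonical_subgeometry_def by blast
qed

section \<open>Vanishing on the pseudo-arc\<close>

text \<open>
  Points of the quadric are given by some representing vector, so the trace vector is first
  compared with the representative on which \<open>Q\<close> is known to vanish. The factor between them may be
  any element of the large field, since the coordinate formula for \<open>Q\<close> is homogeneous over it.
\<close>

lemma quadratic_form_trace_vec_eq_zero:
  fixes c \<alpha> :: "'a::{field,finite}"
  assumes "primepow q" and "CARD('a) = q ^ h"
    and Q: "\<forall>v\<in>Fq_vecs q m. Q v = (\<Sum>j<m. \<Sum>i\<le>j. a i j * v $ i * v $ j)"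
    and sub: "X_sub h q m (P_pt m \<alpha>)
      \<subseteq> {proj_point m v | v. v \<in> Fq_vecs q m \<and> v \<noteq> 0\<^sub>v m \<and> Q v = 0}"
  shows "Q (trace_vec h q m \<alpha> c) = 0"
proof -
  let ?v = "trace_vec h q m \<alpha> c"
  have v: "?v \<in> Fq_vecs q m" by (rule trace_vec_in_Fq_vecs[OF assms(1,2)])
  then have vc: "?v \<in> carrier_vec m" by (simp add: Fq_vecs_def)
  show ?thesis
  proof (cases "?v = 0\<^sub>v m")
    case True
    then show ?thesis using Q v by auto
  next
    case False
    then obtain w where w: "proj_point m ?v = proj_point m w" "w \<in> Fq_vecs q m" "Q w = 0"
      using proj_point_trace_vec_in_X_sub[OF assms(1,2), of m \<alpha> c] sub by blast
    have wc: "w \<in> carrier_vec m" using w by (simp add: Fq_vecs_def)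
    have "?v \<in> proj_point m w" using self_in_proj_point[OF vc] w by simp
    then obtain t where t: "?v = t \<cdot>\<^sub>v w"
      by (auto simp: proj_point_def lin_span_single[OF wc])
    have "Q ?v = (\<Sum>j<m. \<Sum>i\<le>j. a i j * (t \<cdot>\<^sub>v w) $ i * (t \<cdot>\<^sub>v w) $ j)"
      using Q v t by simp
    also have "\<dots> = t ^ 2 * (\<Sum>j<m. \<Sum>i\<le>j. a i j * w $ i * w $ j)"
      unfolding sum_distrib_left using wc
      by (intro sum.cong refl) (auto simp: power2_eq_square)
    finally show ?thesis using Q w by simp
  qed
qed

lemma form_of_trace_vec:
  "(\<Sum>j<m. \<Sum>l\<le>j. a l j * trace_vec h q m \<alpha> c $ l * trace_vec h q m \<alpha> c $ j)
    = (\<Sum>i<h. \<Sum>i'<h. c ^ (q ^ i + q ^ i') * poly (form_poly a m (q ^ i) (q ^ i')) \<alpha>)"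
  (is "?L = ?R")
proof -
  have "?L = (\<Sum>j<m. \<Sum>l\<le>j. \<Sum>i<h. \<Sum>i'<h.
      c ^ (q ^ i + q ^ i') * (a l j * (\<alpha> ^ (q ^ i)) ^ l * (\<alpha> ^ (q ^ i')) ^ j))"
  proof (intro sum.cong refl)
    fix j l assume "j \<in> {..<m}" "l \<in> {..j}"
    then have "a l j * trace_vec h q m \<alpha> c $ l * trace_vec h q m \<alpha> c $ j
        = a l j * ((\<Sum>i<h. c ^ (q ^ i) * (\<alpha> ^ (q ^ i)) ^ l)
            * (\<Sum>i'<h. c ^ (q ^ i') * (\<alpha> ^ (q ^ i')) ^ j))"
      by (simp add: trace_vec_def)
    also have "\<dots> = (\<Sum>i<h. \<Sum>i'<h.
        c ^ (q ^ i + q ^ i') * (a l j * (\<alpha> ^ (q ^ i)) ^ l * (\<alpha> ^ (q ^ i')) ^ j))"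
      by (subst sum_product) (simp add: sum_distrib_left power_add mult_ac)
    finally show "a l j * trace_vec h q m \<alpha> c $ l * trace_vec h q m \<alpha> c $ j = \<dots>" .
  qed
  also have "\<dots> = (\<Sum>j<m. \<Sum>i<h. \<Sum>l\<le>j. \<Sum>i'<h.
      c ^ (q ^ i + q ^ i') * (a l j * (\<alpha> ^ (q ^ i)) ^ l * (\<alpha> ^ (q ^ i')) ^ j))"
    by (intro sum.cong refl sum.swap)
  also have "\<dots> = (\<Sum>i<h. \<Sum>j<m. \<Sum>l\<le>j. \<Sum>i'<h.
      c ^ (q ^ i + q ^ i') * (a l j * (\<alpha> ^ (q ^ i)) ^ l * (\<alpha> ^ (q ^ i')) ^ j))"
    by (rule sum.swap)
  also have "\<dots> = (\<Sum>i<h. \<Sum>j<m. \<Sum>i'<h. \<Sum>l\<le>j.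
      c ^ (q ^ i + q ^ i') * (a l j * (\<alpha> ^ (q ^ i)) ^ l * (\<alpha> ^ (q ^ i')) ^ j))"
    by (intro sum.cong refl sum.swap)
  also have "\<dots> = (\<Sum>i<h. \<Sum>i'<h. \<Sum>j<m. \<Sum>l\<le>j.
      c ^ (q ^ i + q ^ i') * (a l j * (\<alpha> ^ (q ^ i)) ^ l * (\<alpha> ^ (q ^ i')) ^ j))"
    by (intro sum.cong refl sum.swap)
  also have "\<dots> = ?R"
    by (simp add: poly_form_poly sum_distrib_left)
  finally show ?thesis .
qed

text \<open>
  Since \<open>q > 2\<close>, the number \<open>2\<close> arises as \<open>q ^ i + q ^ i'\<close> only from \<open>i = i' = 0\<close>, and \<open>q + 1\<close> only
  from the pairs \<open>(0, 1)\<close> and \<open>(1, 0)\<close>; and the polynomial has degree below \<open>q ^ h\<close>.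
\<close>

lemma double_power_sum_coeffs_zero:
  fixes A :: "nat \<Rightarrow> nat \<Rightarrow> 'a::{field,finite}"
  assumes card: "CARD('a) = q ^ h" and "q \<ge> 3" and "h \<ge> 2"
    and zero: "\<And>c. (\<Sum>i<h. \<Sum>i'<h. c ^ (q ^ i + q ^ i') * A i i') = 0"
  shows "A 0 0 = 0" and "A 0 1 + A 1 0 = 0"
proof -
  define p where "p = (\<Sum>i<h. \<Sum>i'<h. monom (A i i') (q ^ i + q ^ i'))"
  have "degree p \<le> 2 * q ^ (h - 1)"
    unfolding p_def
  proof (intro degree_sum_le)
    fix i i' assume "i \<in> {..<h}" "i' \<in> {..<h}"
    then have "q ^ i + q ^ i' \<le> q ^ (h - 1) + q ^ (h - 1)"
      using \<open>q \<ge> 3\<close> by (intro add_mono power_increasing) auto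
    then show "degree (monom (A i i') (q ^ i + q ^ i')) \<le> 2 * q ^ (h - 1)"
      by (intro order.trans[OF degree_monom_le]) simp
  qed auto
  also have "\<dots> < q * q ^ (h - 1)"
    using \<open>q \<ge> 3\<close> by (intro mult_strict_right_mono) auto
  also have "\<dots> = q ^ h"
    using \<open>h \<ge> 2\<close> by (cases h) auto
  finally have "degree p < card (UNIV :: 'a set)"
    using card by simp
  moreover have "poly p c = 0" for c
    using zero[of c] by (simp add: p_def poly_sum poly_monom mult.commute)
  ultimately have "p = 0"
    by (intro poly_eqI_degree[of UNIV]) auto
  then have coeff0: "(\<Sum>i<h. \<Sum>i'<h. if q ^ i + q ^ i' = n then A i i' else 0) = 0" for n
  proof -
    have "coeff p n = (\<Sum>i<h. \<Sum>i'<h. if q ^ i + q ^ i' = n then A i i' else 0)"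
      by (simp add: p_def coeff_sum)
    then show ?thesis using \<open>p = 0\<close> by simp
  qed
  have pos: "q ^ i \<ge> 1" for i using \<open>q \<ge> 3\<close> by simp
  have big: "q ^ i \<ge> 3" if "i > 0" for i
    using power_increasing[of 1 i q] that \<open>q \<ge> 3\<close> by simp
  have inj: "i = 1" if "q ^ i = q" for i
    using that \<open>q \<ge> 3\<close> power_inject_exp[of q i 1] by simp
  have two: "q ^ i + q ^ i' = 2 \<longleftrightarrow> i = 0 \<and> i' = 0" for i i'
    using big[of i] big[of i'] pos[of i] pos[of i'] by (cases "i = 0"; cases "i' = 0") auto
  have qplus1: "q ^ i + q ^ i' = Suc q \<longleftrightarrow> i = 0 \<and> i' = 1 \<or> i = 1 \<and> i' = 0" for i i'
  proof (cases "i = 0 \<or> i' = 0")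
    case True
    then show ?thesis using inj[of i] inj[of i'] \<open>q \<ge> 3\<close> by (auto dest: sym)
  next
    case False
    then have "q dvd q ^ i + q ^ i'" by (intro dvd_add dvd_power) auto
    moreover have "\<not> q dvd Suc q" using \<open>q \<ge> 3\<close> dvd_add_right_iff[of q q 1] by auto
    ultimately have "q ^ i + q ^ i' \<noteq> Suc q" by metis
    then show ?thesis using False by auto
  qed
  have "(\<Sum>i<h. \<Sum>i'<h. if q ^ i + q ^ i' = 2 then A i i' else 0)
      = (\<Sum>i<h. if i = 0 then (\<Sum>i'<h. if i' = 0 then A 0 0 else 0) else 0)"
    unfolding two by (intro sum.cong refl) (auto intro!: sum.cong)
  then show "A 0 0 = 0"
    using coeff0[of 2] \<open>h \<ge> 2\<close> by simp
  have "(\<Sum>i<h. \<Sum>i'<h. if q ^ i + q ^ i' = Suc q then A i i' else 0)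
      = (\<Sum>i<h. (if i = 0 then (\<Sum>i'<h. if i' = 1 then A 0 1 else 0) else 0)
          + (if i = 1 then (\<Sum>i'<h. if i' = 0 then A 1 0 else 0) else 0))"
    unfolding qplus1 by (intro sum.cong refl) (auto intro!: sum.cong)
  then show "A 0 1 + A 1 0 = 0"
    using coeff0[of "Suc q"] \<open>h \<ge> 2\<close> by (simp add: sum.distrib)
qed

text \<open>
  A polynomial over the subfield commutes with \<open>x \<mapsto> x ^ q\<close>, so its set of roots is a union of orbits and
  one representative of each orbit decides.
\<close>

lemma root_on_full_orbits:
  fixes p :: "'a::{field,finite} poly"
  assumes "primepow q" and "CARD('a) = q ^ h" and "orbit_representatives h q \<Lambda>"
    and coeffs: "\<And>i. coeff p i \<in> Fq q" and roots: "\<And>\<alpha>. \<alpha> \<in> \<Lambda> \<Longrightarrow> poly p \<alpha> = 0"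
    and x: "card (orbit (\<lambda>x. x ^ q) x) = h"
  shows "poly p x = 0"
proof -
  have "orbit (\<lambda>x. x ^ q) x \<in> full_frobenius_orbits h q"
    using x by (auto simp: full_frobenius_orbits_def)
  then obtain \<alpha> where \<alpha>: "\<alpha> \<in> \<Lambda>" "\<alpha> \<in> orbit (\<lambda>x. x ^ q) x"
    using assms(3) unfolding orbit_representatives_def by blast
  then obtain n where "\<alpha> = x ^ (q ^ n)"
    by (auto simp: orbit_altdef funpow_power)
  then have "poly p x ^ (q ^ n) = 0"
    using roots[OF \<alpha>(1)] poly_Fq_power[OF assms(1,2) coeffs] by simp
  then show ?thesis by simp
qed

lemma no_quadric_contains_arc:
  fixes h k q :: nat and \<Lambda> :: "'a::{field,finite} set"
  assumes "h > 0" and "k > 0"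
    and pp: "primepow q" and q: "q \<ge> h * k + 1"
    and card: "CARD('a) = q ^ h"
    and reps: "orbit_representatives h q \<Lambda>"
    and h1: "h = 1 \<Longrightarrow> k \<le> 2"
    and S: "quadric q (h * k) S" and sub: "\<forall>X \<in> P_arc h k q \<Lambda>. X \<subseteq> S"
  shows False
proof -
  define m where "m = h * k"
  have m: "0 < m" "m < q" using assms(1,2) q by (auto simp: m_def)
  obtain Q a where a: "\<forall>j<m. \<forall>i\<le>j. a i j \<in> Fq q"
    and Q: "\<forall>v\<in>Fq_vecs q m. Q v = (\<Sum>j<m. \<Sum>i\<le>j. a i j * v $ i * v $ j)"
    and nz: "\<exists>v\<in>Fq_vecs q m. Q v \<noteq> 0"
    and S_eq: "S = {proj_point m v | v. v \<in> Fq_vecs q m \<and> v \<noteq> 0\<^sub>v m \<and> Q v = 0}"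
    using S unfolding quadric_def quadratic_form_def m_def by blast
  have vanish: "(\<Sum>i<h. \<Sum>i'<h. c ^ (q ^ i + q ^ i') * poly (form_poly a m (q ^ i) (q ^ i')) \<alpha>) = 0"
    if "\<alpha> \<in> \<Lambda>" for \<alpha> c
  proof -
    have "X_sub h q m (P_pt m \<alpha>) \<in> P_arc h k q \<Lambda>"
      using that by (auto simp: P_arc_def m_def)
    then have "Q (trace_vec h q m \<alpha> c) = 0"
      using sub unfolding S_eq by (intro quadratic_form_trace_vec_eq_zero[OF pp card Q]) blast
    then show ?thesis
      using Q trace_vec_in_Fq_vecs[OF pp card, of m \<alpha> c] by (simp flip: form_of_trace_vec)
  qed
  let ?D = "form_poly a m 1 1" and ?B = "form_poly a m 1 q + form_poly a m q 1"
  let ?N = "{x::'a. card (orbit (\<lambda>x. x ^ q) x) = h}"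
  have coeffs: "coeff ?D i \<in> Fq q" "coeff ?B i \<in> Fq q" for i
    using coeff_form_poly_in_Fq[OF pp card a] Fq_add[OF pp card] by auto
  note roots = root_on_full_orbits[OF pp card reps]
  have "a i j = 0" if "j < m" "i \<le> j" for i j
  proof (cases "h = 1")
    case True
    \<comment> \<open>There are no proper conjugates, so \<open>c = 1\<close> already gives the value of the form at \<open>P\<^sub>\<alpha>\<close>.\<close>
    have "poly ?D \<alpha> = 0" if "\<alpha> \<in> \<Lambda>" for \<alpha>
      using vanish[OF that, of 1] True by simp
    moreover have "card (orbit (\<lambda>x. x ^ q) x) = h" for x :: 'a
      using fixed_by_smaller_power_if_orbit_small[OF card] True by fastforce
    ultimately have "poly ?D x = 0" for x
      using roots coeffs by blast
    moreover have "degree ?D < CARD('a)"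
      using degree_form_poly[of a m 1 1] m h1 True card by (simp add: m_def)
    ultimately have "?D = 0"
      by (intro poly_eqI_degree[of UNIV]) auto
    then show ?thesis
      using form_coeffs_zero_if_diagonal_poly_zero that h1 True by (simp add: m_def)
  next
    case False
    then have h2: "h \<ge> 2" using \<open>h > 0\<close> by simp
    have "h * k \<ge> 2 * 1" using h2 \<open>k > 0\<close> by (intro mult_le_mono) auto
    then have q3: "q \<ge> 3" using q by simp
    have "poly ?D \<alpha> = 0" "poly ?B \<alpha> = 0" if "\<alpha> \<in> \<Lambda>" for \<alpha>
      using double_power_sum_coeffs_zero[OF card q3 h2 vanish[OF that]] by auto
    then have "poly ?D x = 0" "poly ?B x = 0" if "x \<in> ?N" for x
      using roots[OF coeffs(1)] roots[OF coeffs(2)] that by blast+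
    moreover have "degree ?D < card ?N" "degree ?B < card ?N"
    proof -
      have "(m - 1) * (1 + e) \<le> (q - 2) * (q + 1)" if "e \<le> q" for e
        using m that by (intro mult_le_mono) auto
      then have bound: "degree (form_poly a m 1 e) \<le> (q - 2) * (q + 1)"
        "degree (form_poly a m e 1) \<le> (q - 2) * (q + 1)" if "e \<le> q" for e
        using degree_form_poly[of a m 1 e] degree_form_poly[of a m e 1] that
        by (metis add.commute order.trans)+
      then have "degree ?D \<le> (q - 2) * (q + 1)" "degree ?B \<le> (q - 2) * (q + 1)"
        using q3 by (auto intro!: degree_add_le simp del: One_nat_def)
      then show "degree ?D < card ?N" "degree ?B < card ?N"
        using card_full_orbit_gt[OF card q3 h2] by auto
    qed
    ultimately have "?D = 0" "?B = 0"
      by (auto intro!: poly_eqI_degree[of ?N])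
    then show ?thesis
      using form_coeffs_zero_if_polys_zero m that by fastforce
  qed
  then have "Q v = 0" if "v \<in> Fq_vecs q m" for v
    using Q that by auto
  then show False using nz by blast
qed

theorem theorem3p14:
  fixes h k q :: nat and \<Lambda> :: "'a::{field,finite} set"
  assumes "h > 0" and "k > 0"
    and "primepow q" and "q \<ge> h * k + 1"
    and "CARD('a) = q ^ h"
    and "orbit_representatives h q \<Lambda>"
    and "h = 1 \<Longrightarrow> k \<le> 2"
  shows "\<not> (\<exists>S. quadric q (h * k) S \<and> (\<forall>X \<in> P_arc h k q \<Lambda>. X \<subseteq> S)) \<and>
         \<not> intersection_of_quadrics q (h * k) (P_arc h k q \<Lambda>)"
proof (intro conjI)
  show none: "\<not> (\<exists>S. quadric q (h * k) S \<and> (\<forall>X \<in> P_arc h k q \<Lambda>. X \<subseteq> S))"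
    using no_quadric_contains_arc[OF assms] by blast
  show "\<not> intersection_of_quadrics q (h * k) (P_arc h k q \<Lambda>)"
  proof
    assume "intersection_of_quadrics q (h * k) (P_arc h k q \<Lambda>)"
    then obtain F where F: "F \<noteq> {}" "\<forall>S\<in>F. quadric q (h * k) S"
        "\<forall>X\<in>P_arc h k q \<Lambda>. X \<subseteq> \<Inter>F"
      unfolding intersection_of_quadrics_def by (elim exE conjE)
    then obtain S where "S \<in> F" by auto
    then have "\<forall>X\<in>P_arc h k q \<Lambda>. X \<subseteq> S" using F(3) Inter_lower order.trans by metis
    with F(2) \<open>S \<in> F\<close> none show False by auto
  qed
qed

end
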